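(* Let $(\mathcal{X},d)$ be a separable metric space with Borel probability measure $\mu$, let $X_1,X_2,\dots$ be independent random variables with law $\mu$, and let $r>0$. Then $\hat M(\mathbf{X}_1^n,r)$ converges to $0$ almost surely as $n\to\infty$.
   Context: $\mathbf{X}_1^n=(X_1,\dots,X_n)$ and $\hat M(\mathbf{X}_1^n,r)=\mu\{y\in\mathcal{X}: d(y,X_i)>r\ \text{for all } i\in\{1,\dots,n\}\}$ is the conditional missing mass. *)

theory Defs
  imports "HOL-Probability.Probability"
begin

text \<open>
  Sample points are indexed from 1: only \<open>x 1, \<dots>, x n\<close> matter. For \<open>\<mu>\<close> Borel
  the measured set is open, hence measurable.
\<close>

definition cond_missing_mass ::
    "'a::metric_space measure \<Rightarrow> (nat \<Rightarrow> 'a) \<Rightarrow> nat \<Rightarrow> real \<Rightarrow> real" where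
  "cond_missing_mass \<mu> x n r = measure \<mu> {y. \<forall>i\<in>{1..n}. dist y (x i) > r}"

end

theory Submission
  imports Defs
begin

text \<open>
  Cover the space by the balls of radius \<open>r/2\<close> around a countable dense set. Almost surely every
  such ball of positive measure is hit by the sample, and then each of its points has a sample
  point within distance \<open>r\<close>. The points that are never covered thus lie in a countable union of
  null balls, and continuity from above gives the limit.
\<close>

text \<open>By independence, \<open>n\<close> of the variables all miss \<open>B\<close> with
  probability \<open>(1 - p) ^ n\<close>, where \<open>p > 0\<close> is the mass of
  \<open>B\<close>. Missing \<open>B\<close> at every index is thus at most this likely for every
  \<open>n\<close>, hence has probability 0.\<close>

lemma (in prob_space) AE_indep_vars_hit:
  fixes X :: "nat \<Rightarrow> 'a \<Rightarrow> 'b::topological_space"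
  assumes ind: "indep_vars (\<lambda>_. borel) X I"
    and inf: "infinite I"
    and law: "\<And>i. i \<in> I \<Longrightarrow> distr M borel (X i) = \<mu>"
    and B: "B \<in> sets borel"
    and pos: "measure \<mu> B > 0"
  shows "AE \<omega> in M. \<exists>i\<in>I. X i \<omega> \<in> B"
proof -
  have rv [measurable]: "X i \<in> borel_measurable M" if "i \<in> I" for i
    using ind that unfolding indep_vars_def by auto
  define p where "p = measure \<mu> B"
  have miss: "prob (X i -` (- B) \<inter> space M) = 1 - p" if i: "i \<in> I" for i
  proof -
    \<comment> \<open>\<open>\<mu>\<close> enters only as the common law, so the complement rule is
      applied in \<open>distr M borel (X i)\<close>.\<close>
    interpret D: prob_space "distr M borel (X i)"
      by (rule prob_space_distr) (use i rv in auto)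
    have "prob (X i -` (- B) \<inter> space M) = measure (distr M borel (X i)) (- B)"
      using B i rv by (subst measure_distr) auto
    also have "\<dots> = 1 - measure (distr M borel (X i)) B"
      using B D.prob_compl[of B] by (simp add: Compl_eq_Diff_UNIV)
    finally show ?thesis
      using law[OF i] by (simp add: p_def)
  qed
  obtain i0 where "i0 \<in> I"
    using inf by fastforce
  then have p1: "0 \<le> 1 - p"
    using miss[of i0] by (metis measure_nonneg)
  define N where "N = {\<omega> \<in> space M. \<forall>i\<in>I. X i \<omega> \<notin> B}"
  \<comment> \<open>Countability makes the intersection of the miss events over all of
    \<open>I\<close> measurable.\<close>
  have cI: "countable I" by simp
  have Nev [measurable]: "N \<in> events"
    unfolding N_def using B cI by measurable
  have bound: "prob N \<le> (1 - p) ^ n" for n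
  \<comment> \<open>The product rule for independent variables asks for a nonempty index set; for
    \<open>n = 0\<close> the bound is just \<open>prob N \<le> 1\<close>.\<close>
  proof (cases "n = 0")
    case False
    obtain J where J: "J \<subseteq> I" "finite J" "card J = n"
      using inf infinite_arbitrarily_large by blast
    with False have ne: "J \<noteq> {}" by auto
    have ev: "(\<Inter>j\<in>J. X j -` (- B) \<inter> space M) \<in> events"
      using J ne B rv by (intro sets.finite_INT) (auto intro!: measurable_sets[of _ _ borel])
    have "prob N \<le> prob (\<Inter>j\<in>J. X j -` (- B) \<inter> space M)"
      by (rule finite_measure_mono[OF _ ev]) (use J in \<open>auto simp: N_def\<close>)
    also have "\<dots> = (\<Prod>j\<in>J. prob (X j -` (- B) \<inter> space M))"
      using J ne B by (intro indep_varsD[OF ind]) auto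
    also have "\<dots> = (\<Prod>j\<in>J. 1 - p)"
      using J miss by (intro prod.cong) auto
    also have "\<dots> = (1 - p) ^ n"
      using J by simp
    finally show ?thesis .
  qed simp
  have "(\<lambda>n. (1 - p) ^ n) \<longlonglongrightarrow> 0"
    using pos p1 by (intro LIMSEQ_realpow_zero) (auto simp: p_def)
  then have "prob N \<le> 0"
    by (rule LIMSEQ_le_const) (use bound in auto)
  then have "N \<in> null_sets M"
    by (simp add: Nev emeasure_eq_measure null_sets_def measure_le_0_iff)
  then show ?thesis
    by (rule AE_I') (auto simp: N_def)
qed

lemma open_dist_greater_finite:
  fixes x :: "'i \<Rightarrow> 'a::metric_space"
  assumes "finite I"
  shows "open {y. \<forall>i\<in>I. dist y (x i) > r}"
proof -
  have "open (\<Inter>i\<in>I. {y. dist y (x i) > r})"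
    using assms by (intro open_INT ballI open_Collect_less continuous_intros)
  moreover have "(\<Inter>i\<in>I. {y. dist y (x i) > r}) = {y. \<forall>i\<in>I. dist y (x i) > r}"
    by auto
  ultimately show ?thesis by simp
qed

text \<open>The uncovered sets are open and shrink as \<open>n\<close> grows, so their measures tend
  to that of their intersection. The sequence \<open>x\<close> is fixed here; the theorem applies
  this to each sample path.\<close>

lemma cond_missing_mass_LIMSEQ:
  assumes "finite_measure \<mu>" and borel: "sets \<mu> = sets borel"
  shows "(\<lambda>n. cond_missing_mass \<mu> x n r)
    \<longlonglongrightarrow> measure \<mu> {y. \<forall>i\<ge>1. dist y (x i) > r}"
proof -
  interpret finite_measure \<mu> by fact
  define A where "A n = {y. \<forall>i\<in>{1..n}. dist y (x i) > r}" for n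
  have "(\<lambda>n. measure \<mu> (A n)) \<longlonglongrightarrow> measure \<mu> (\<Inter>n. A n)"
  proof (rule finite_Lim_measure_decseq)
    show "range A \<subseteq> sets \<mu>"
      unfolding A_def borel using open_dist_greater_finite by (auto intro!: borel_open)
    show "decseq A"
      unfolding A_def decseq_def by auto
  qed
  moreover have "(\<Inter>n. A n) = {y. \<forall>i\<ge>1. dist y (x i) > r}"
    unfolding A_def by fastforce
  ultimately show ?thesis
    by (simp add: cond_missing_mass_def A_def)
qed

theorem proposition4p17:
  fixes \<mu> :: "'a::metric_space measure"
    and P :: "'b measure"
    and X :: "nat \<Rightarrow> 'b \<Rightarrow> 'a"
    and r :: real
  assumes "separable_space (euclidean :: 'a topology)"
    and "prob_space \<mu>"
    and "sets \<mu> = sets borel"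
    and "prob_space P"
    and "prob_space.indep_vars P (\<lambda>_. borel) X {1..}"
    and "\<And>i. i \<ge> 1 \<Longrightarrow> distr P borel (X i) = \<mu>"
    and "r > 0"
  shows "AE \<omega> in P. (\<lambda>n. cond_missing_mass \<mu> (\<lambda>i. X i \<omega>) n r) \<longlonglongrightarrow> 0"
proof -
  interpret mu: prob_space \<mu> by fact
  interpret P: prob_space P by fact
  obtain D :: "'a set" where D: "countable D" "closure D = UNIV"
    using assms(1) unfolding separable_space_def by auto
  define Z where "Z = (\<Union>c\<in>{c\<in>D. measure \<mu> (ball c (r/2)) = 0}. ball c (r/2))"
  have ball: "ball c (r/2) \<in> sets \<mu>" for c
    using assms(3) by auto
  have Z: "Z \<in> null_sets \<mu>"
    unfolding Z_def using D(1) ball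
    by (intro null_sets_UN') (auto simp: null_sets_def mu.emeasure_eq_measure)
  have "AE \<omega> in P. \<forall>c\<in>{c\<in>D. measure \<mu> (ball c (r/2)) > 0}. \<exists>i\<in>{1..}. X i \<omega> \<in> ball c (r/2)"
  \<comment> \<open>Each ball has its own exceptional null set; as \<open>D\<close> is countable,
    these combine into a single one.\<close>
  proof (subst AE_ball_countable)
    show "countable {c \<in> D. 0 < measure \<mu> (ball c (r/2))}"
      using D(1) by simp
    show "\<forall>c\<in>{c\<in>D. measure \<mu> (ball c (r/2)) > 0}. AE \<omega> in P. \<exists>i\<in>{1..}. X i \<omega> \<in> ball c (r/2)"
      by (intro ballI P.AE_indep_vars_hit[OF assms(5), where \<mu> = \<mu>])
        (auto simp: assms(6) infinite_Ici)
  qed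
  then show ?thesis
  proof eventually_elim
    case (elim \<omega>)
    have "{y. \<forall>i\<ge>1. dist y (X i \<omega>) > r} \<subseteq> Z"
    proof
      fix y assume y: "y \<in> {y. \<forall>i\<ge>1. dist y (X i \<omega>) > r}"
      \<comment> \<open>With radius \<open>r/2\<close>, a sample point in the ball around
        \<open>c\<close> lies within \<open>r\<close> of \<open>y\<close> by the triangle
        inequality. As \<open>y\<close> is never covered, that ball is not hit and must be
        null.\<close>
      obtain c where c: "c \<in> D" "dist c y < r/2"
        using D(2) assms(7) closure_approachable[of y D] by (metis UNIV_I half_gt_zero)
      have "measure \<mu> (ball c (r/2)) = 0"
      proof (rule ccontr)
        assume "measure \<mu> (ball c (r/2)) \<noteq> 0"
        then have "measure \<mu> (ball c (r/2)) > 0"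
          by (simp add: zero_less_measure_iff)
        then obtain i where i: "i \<ge> 1" "dist c (X i \<omega>) < r/2"
          using elim c(1) by auto
        then have "dist y (X i \<omega>) < r"
          using c(2) dist_triangle_less_add[of y c "r/2" "X i \<omega>" "r/2"] by (simp add: dist_commute)
        with y i(1) show False by force
      qed
      with c show "y \<in> Z"
        by (auto simp: Z_def)
    qed
    \<comment> \<open>Monotonicity asks for measurability of the larger set, which \<open>Z\<close>
      has as a null set.\<close>
    then have "measure \<mu> {y. \<forall>i\<ge>1. dist y (X i \<omega>) > r} \<le> measure \<mu> Z"
      using Z by (intro mu.finite_measure_mono) auto
    also have "measure \<mu> Z = 0"
      using Z by (simp add: null_sets_def measure_def)
    finally have "measure \<mu> {y. \<forall>i\<ge>1. dist y (X i \<omega>) > r} = 0"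
      by (simp add: measure_le_0_iff)
    then show ?case
      using cond_missing_mass_LIMSEQ[OF mu.finite_measure_axioms assms(3), of "\<lambda>i. X i \<omega>" r]
      by simp
  qed
qed

end
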